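(* Let $R$ be a 2-fir. For non-units $a,b\in R\setminus U(R)$ the following are equivalent: (i) $ab$ is fully reducible. (ii) $a,b$ are fully reducible and $R/Rab\cong R/Ra\oplus R/Rb$ as left $R$-modules. (iii) $a,b$ are fully reducible and $1\in Ra+bR$. (iv) $a,b$ are fully reducible and for all $p\in V(a)$, $pb$ is fully reducible. (v) $a,b$ are fully reducible and for any $F$-basis $\{p_1,\dots,p_l\}$ of $V(a)$, $p_ib$ is fully reducible for $i=1,\dots,l$. (vi) $a,b$ are fully reducible and for any $p\in V(a)$ and any $q\in V'(b)$, $pq$ is fully reducible. (vii) $a,b$ are fully reducible and $\mathbb I_R(Ra)\subseteq Ra+bR$.
   Context: Rings are associative with $1$, not necessarily commutative. A 2-fir is a domain $R$ such that for all $a,b\in R$ with $aR\cap bR\neq 0$ there are $c,d\in R$ with $aR\cap bR=cR$ and $aR+bR=dR$ (this condition is left-right symmetric). $U(R)$ is the group of units. An atom is a nonzero non-unit that is not a product of two non-units; $\mathcal A$ is the set of atoms. The length $\ell(a)$ of $a$ is the least $n$ such that $a$ is a product of $n$ atoms, $0$ if $a$ is a unit, and $\infty$ if $a$ is neither a unit nor a finite product of atoms; $\mathcal F=\{x\in R: \ell(x)<\infty\}$ (so $0\notin\mathcal F$, $U(R)\subseteq\mathcal F$). The intersection of an empty family of left ideals is $R$. An element $f\in\mathcal F$ is fully reducible if there are finitely many atoms $p_1,\dots,p_n\in R$ with $Rf=\bigcap_{i=1}^nRp_i$ (in particular fully reducible elements are nonzero). For $a\in R\setminus\{0\}$: $V(a)=\{p\in\mathcal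 A: a\in Rp\}$ and $V'(a)=\{p\in\mathcal A: a\in pR\}$. For $a\in R$: $\mathbb I_R(Ra)=\{f\in R: af\in Ra\}$ (the idealizer of $Ra$). A subset $\Delta\subseteq\mathcal F\setminus U(R)$ is $F$-algebraic if $\bigcap_{\delta\in\Delta}R\delta\neq0$ (each $V(a)$ is $F$-algebraic). For $\Delta$ $F$-algebraic, $d\in\mathcal F$ is $F$-dependent on $\Delta$ if $\Delta\cup\{d\}$ is $F$-algebraic and there is a finite subset $\Gamma\subseteq\Delta$ with $Rd+\bigcap_{\gamma\in\Gamma}R\gamma\neq R$. $\Delta$ is $F$-independent if no $\delta\in\Delta$ is $F$-dependent on $\Delta\setminus\{\delta\}$. An $F$-basis of $\Delta$ is an $F$-independent subset $B\subseteq\Delta$ such that every element of $\Delta$ is $F$-dependent on $B$. *)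

theory Defs
  imports Complex_Main "HOL-Library.Set_Algebras" "HOL-Library.Extended_Nat"
begin

text \<open>Sums of one-sided ideals are written with the elementwise sum of sets from
  \<^theory>\<open>HOL-Library.Set_Algebras\<close>; in particular the zero ideal is \<open>{0}\<close> and
  the empty intersection of left ideals is the whole ring \<open>UNIV\<close>.\<close>

definition lideal :: "'a::ring_1 \<Rightarrow> 'a set" where
  "lideal a = {r * a | r. True}"

definition rideal :: "'a::ring_1 \<Rightarrow> 'a set" where
  "rideal a = {a * r | r. True}"

definition two_fir :: "'a::ring_1_no_zero_divisors itself \<Rightarrow> bool" where
  "two_fir _ \<longleftrightarrow> (\<forall>a b :: 'a. rideal a \<inter> rideal b \<noteq> {0} \<longrightarrow>
     (\<exists>c d. rideal a \<inter> rideal b = rideal c \<and> rideal a + rideal b = rideal d))"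

definition ring_units :: "'a::ring_1 set" where
  "ring_units = {u. \<exists>v. u * v = 1 \<and> v * u = 1}"

definition atoms :: "'a::ring_1 set" where
  "atoms = {p. p \<noteq> 0 \<and> p \<notin> ring_units \<and>
     \<not> (\<exists>x y. x \<notin> ring_units \<and> y \<notin> ring_units \<and> p = x * y)}"

definition prod_of_atoms :: "nat \<Rightarrow> 'a::ring_1 \<Rightarrow> bool" where
  "prod_of_atoms n a \<longleftrightarrow> (\<exists>ps. length ps = n \<and> set ps \<subseteq> atoms \<and> a = prod_list ps)"

definition elem_length :: "'a::ring_1 \<Rightarrow> enat" where
  "elem_length a =
    (if a \<in> ring_units then 0
     else if \<exists>n. prod_of_atoms n a then enat (LEAST n. prod_of_atoms n a)
     else \<infinity>)"

definition finite_length :: "'a::ring_1 set" where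
  "finite_length = {x. elem_length x < \<infinity>}"

definition fully_reducible :: "'a::ring_1 \<Rightarrow> bool" where
  "fully_reducible f \<longleftrightarrow> f \<in> finite_length \<and>
     (\<exists>P. finite P \<and> P \<subseteq> atoms \<and> lideal f = (\<Inter>p\<in>P. lideal p))"

text \<open>\<open>V a\<close> and \<open>V' a\<close> are only meaningful for \<open>a \<noteq> 0\<close>.\<close>

definition V :: "'a::ring_1 \<Rightarrow> 'a set" where
  "V a = {p \<in> atoms. a \<in> lideal p}"

definition V' :: "'a::ring_1 \<Rightarrow> 'a set" where
  "V' a = {p \<in> atoms. a \<in> rideal p}"

definition idealizer :: "'a::ring_1 \<Rightarrow> 'a set" where
  "idealizer a = {f. a * f \<in> lideal a}"

definition F_algebraic :: "'a::ring_1 set \<Rightarrow> bool" where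
  "F_algebraic D \<longleftrightarrow> D \<subseteq> finite_length - ring_units \<and> (\<Inter>\<delta>\<in>D. lideal \<delta>) \<noteq> {0}"

definition F_dependent :: "'a::ring_1 \<Rightarrow> 'a set \<Rightarrow> bool" where
  "F_dependent d D \<longleftrightarrow> F_algebraic D \<and> d \<in> finite_length \<and> F_algebraic (D \<union> {d}) \<and>
     (\<exists>G. finite G \<and> G \<subseteq> D \<and> lideal d + (\<Inter>\<gamma>\<in>G. lideal \<gamma>) \<noteq> UNIV)"

definition F_independent :: "'a::ring_1 set \<Rightarrow> bool" where
  "F_independent D \<longleftrightarrow> F_algebraic D \<and> (\<forall>\<delta>\<in>D. \<not> F_dependent \<delta> (D - {\<delta>}))"

definition F_basis :: "'a::ring_1 set \<Rightarrow> 'a set \<Rightarrow> bool" where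
  "F_basis B D \<longleftrightarrow> F_algebraic D \<and> B \<subseteq> D \<and> F_independent B \<and> (\<forall>\<delta>\<in>D. F_dependent \<delta> B)"

text \<open>The module notions of the libraries require a commutative ring of scalars, so left
  modules over the ring given by a type are represented here by explicit records.\<close>

record ('r, 'm) lmodule =
  lcarrier :: "'m set"
  ladd :: "'m \<Rightarrow> 'm \<Rightarrow> 'm"
  lsmult :: "'r \<Rightarrow> 'm \<Rightarrow> 'm"

text \<open>\<open>R/Ra\<close>: the elements are the cosets \<open>x + Ra\<close>. The scalar multiple of a coset \<open>C\<close>
  by \<open>r\<close> is \<open>rC + Ra\<close>, since \<open>rC\<close> itself need not be a full coset.\<close>

definition quot_lmodule :: "'a::ring_1 \<Rightarrow> ('a, 'a set) lmodule" where
  "quot_lmodule a =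
    \<lparr>lcarrier = range (\<lambda>x. x +o lideal a),
     ladd = (\<lambda>C D. C + D),
     lsmult = (\<lambda>r C. r *o C + lideal a)\<rparr>"

lemma quot_lmodule_ladd:
  "ladd (quot_lmodule a) (x +o lideal a) (y +o lideal a) = (x + y) +o lideal a"
proof -
  have "lideal a + lideal a = lideal a"
  proof
    show "lideal a + lideal a \<subseteq> lideal a"
      unfolding lideal_def set_plus_def by (auto simp: distrib_right [symmetric])
    have "0 \<in> lideal a"
      unfolding lideal_def by (auto intro: exI [of _ 0])
    then show "lideal a \<subseteq> lideal a + lideal a"
      unfolding set_plus_def by force
  qed
  then show ?thesis
    by (simp add: quot_lmodule_def set_plus_rearrange)
qed

lemma quot_lmodule_lsmult:
  "lsmult (quot_lmodule a) r (x +o lideal a) = (r * x) +o lideal a"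
proof -
  have "r *o (x +o lideal a) + lideal a \<subseteq> (r * x) +o lideal a"
  proof
    fix z assume "z \<in> r *o (x +o lideal a) + lideal a"
    then obtain s t where "z = r * (x + s * a) + t * a"
      by (auto simp: set_plus_def elt_set_plus_def elt_set_times_def lideal_def)
    then have "z = r * x + (r * s + t) * a"
      by (simp add: algebra_simps)
    then show "z \<in> (r * x) +o lideal a"
      by (auto simp: elt_set_plus_def lideal_def)
  qed
  moreover have "(r * x) +o lideal a \<subseteq> r *o (x +o lideal a) + lideal a"
  proof
    fix z assume "z \<in> (r * x) +o lideal a"
    then obtain t where "z = r * x + t * a"
      by (auto simp: elt_set_plus_def lideal_def)
    then have "z = r * (x + 0 * a) + t * a"
      by simp
    then show "z \<in> r *o (x +o lideal a) + lideal a"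
      unfolding set_plus_def elt_set_plus_def elt_set_times_def lideal_def by blast
  qed
  ultimately show ?thesis
    by (simp add: quot_lmodule_def)
qed

definition lmodule_sum ::
    "('r, 'm) lmodule \<Rightarrow> ('r, 'n) lmodule \<Rightarrow> ('r, 'm \<times> 'n) lmodule" where
  "lmodule_sum M N =
    \<lparr>lcarrier = lcarrier M \<times> lcarrier N,
     ladd = (\<lambda>(x, y) (x', y'). (ladd M x x', ladd N y y')),
     lsmult = (\<lambda>r (x, y). (lsmult M r x, lsmult N r y))\<rparr>"

definition lmodule_iso :: "('r, 'm) lmodule \<Rightarrow> ('r, 'n) lmodule \<Rightarrow> bool" where
  "lmodule_iso M N \<longleftrightarrow> (\<exists>\<phi>. bij_betw \<phi> (lcarrier M) (lcarrier N) \<and>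
     (\<forall>x\<in>lcarrier M. \<forall>y\<in>lcarrier M. \<phi> (ladd M x y) = ladd N (\<phi> x) (\<phi> y)) \<and>
     (\<forall>r. \<forall>x\<in>lcarrier M. \<phi> (lsmult M r x) = lsmult N r (\<phi> x)))"

end

theory Submission
  imports Defs
begin

text \<open>
  Everything rests on colon ideals: for an atom \<open>p\<close> of a 2-fir, a nonzero ideal
  \<open>{r. r y \<in> Rp}\<close> is \<open>R\<close> or \<open>Rq\<close> for an atom \<open>q\<close>. Hence a nonzero principal left ideal
  which is a colon ideal \<open>{r. r y \<in> Rf}\<close> of a fully reducible \<open>f\<close> has a fully reducible generator.

  If \<open>1 = xa + by\<close>, then \<open>Rab = Rb \<inter> {r. r y \<in> Ra}\<close>, so \<open>ab\<close> is fully reducible.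
  Conversely, if \<open>Rab\<close> is a finite intersection of maximal principal left ideals, then \<open>Rb\<close> has
  a complement \<open>Rz\<close> in the lattice of principal left ideals above \<open>Rab\<close>, and
  \<open>1 = ub + vz\<close> gives \<open>(1 - bu)b = bvz \<in> Rb \<inter> Rz = Rab\<close>, i.e. \<open>1 - bu \<in> Ra\<close>.
  An isomorphism as in (ii) writes \<open>Rab\<close> as the intersection of a colon ideal of \<open>Ra\<close> and one of
  \<open>Rb\<close>. For (iv) and (v), \<open>Ra = \<Inter> Rp\<close> implies \<open>Rab = \<Inter> Rpb\<close>. For (vi), \<open>bR\<close> is built up by
  comaximal intersections \<open>qR \<inter> hR\<close> with atoms \<open>q\<close>, along which \<open>1 \<in> Ra + qR\<close> and
  \<open>1 \<in> Ra + hR\<close> imply \<open>1 \<in> Ra + (qR \<inter> hR)\<close>.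
\<close>

section \<open>Principal one-sided ideals, units and finite length\<close>

lemma mem_lideal: "x \<in> lideal a \<longleftrightarrow> (\<exists>r. x = r * a)"
  by (auto simp: lideal_def)

lemma mem_rideal: "x \<in> rideal a \<longleftrightarrow> (\<exists>r. x = a * r)"
  by (auto simp: rideal_def)

lemma lideal_self [simp]: "a \<in> lideal a"
  by (metis mem_lideal mult_1_left)

lemma lideal_mult: "x \<in> lideal a \<Longrightarrow> r * x \<in> lideal a"
  by (metis mem_lideal mult.assoc)

lemma lideal_add: "x \<in> lideal a \<Longrightarrow> y \<in> lideal a \<Longrightarrow> x + y \<in> lideal a"
  by (metis mem_lideal distrib_right)

lemma lideal_diff: "x \<in> lideal a \<Longrightarrow> y \<in> lideal a \<Longrightarrow> x - y \<in> lideal a"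
  by (metis mem_lideal left_diff_distrib)

lemma zero_in_lideal [simp]: "0 \<in> lideal a"
  by (metis mem_lideal mult_zero_left)

lemma lideal_subset_iff: "lideal a \<subseteq> lideal b \<longleftrightarrow> a \<in> lideal b"
  by (metis lideal_mult lideal_self mem_lideal subset_iff)

lemma lideal_one [simp]: "lideal 1 = UNIV"
  by (auto simp: mem_lideal)

lemma mem_lideal_plus: "x \<in> lideal a + lideal b \<longleftrightarrow> (\<exists>r s. x = r * a + s * b)"
  unfolding set_plus_def lideal_def by blast

lemma mem_rideal_plus: "x \<in> rideal a + rideal b \<longleftrightarrow> (\<exists>r s. x = a * r + b * s)"
  unfolding set_plus_def rideal_def by blast

lemma mem_lideal_plus_rideal: "x \<in> lideal a + rideal b \<longleftrightarrow> (\<exists>r s. x = r * a + b * s)"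
  unfolding set_plus_def lideal_def rideal_def by blast

text \<open>Domains are Dedekind finite: cancelling \<open>x\<close> in \<open>x * s * x = x\<close>
  gives \<open>x * s = 1\<close>.\<close>

lemma left_inverse_imp_unit:
  fixes x :: "'a::ring_1_no_zero_divisors"
  assumes "s * x = 1"
  shows "x \<in> ring_units"
proof -
  have "x \<noteq> 0" using assms by auto
  have "(x * s) * x = 1 * x" using assms by (simp add: mult.assoc)
  then have "x * s = 1" using \<open>x \<noteq> 0\<close> mult_right_cancel by blast
  then show ?thesis using assms by (auto simp: ring_units_def)
qed

lemma lideal_UNIV_iff:
  fixes x :: "'a::ring_1_no_zero_divisors"
  shows "lideal x = UNIV \<longleftrightarrow> x \<in> ring_units"
proof
  assume "lideal x = UNIV"
  then have "1 \<in> lideal x" by simp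
  then show "x \<in> ring_units" by (metis mem_lideal left_inverse_imp_unit)
next
  assume "x \<in> ring_units"
  then have "1 \<in> lideal x" unfolding mem_lideal ring_units_def by fastforce
  then show "lideal x = UNIV" by (metis lideal_mult mult_1_right UNIV_eq_I)
qed

lemma atom_nonzero: "p \<in> atoms \<Longrightarrow> p \<noteq> 0"
  by (simp add: atoms_def)

lemma atom_nonunit: "p \<in> atoms \<Longrightarrow> p \<notin> ring_units"
  by (simp add: atoms_def)

lemma finite_length_iff:
  "f \<in> finite_length \<longleftrightarrow> f \<in> ring_units \<or> (\<exists>n. prod_of_atoms n f)"
  by (auto simp: finite_length_def elem_length_def zero_enat_def)

lemma atom_finite_length: "p \<in> atoms \<Longrightarrow> p \<in> finite_length"
  by (auto simp: finite_length_iff prod_of_atoms_def intro!: exI [of _ "[p]"])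

lemma finite_length_nonzero:
  fixes f :: "'a::ring_1_no_zero_divisors"
  assumes "f \<in> finite_length"
  shows "f \<noteq> 0"
proof
  assume "f = 0"
  moreover have "(0::'a) \<notin> ring_units" by (simp add: ring_units_def)
  ultimately obtain ps :: "'a list" where "set ps \<subseteq> atoms" "prod_list ps = 0"
    using assms by (metis finite_length_iff prod_of_atoms_def)
  then show False using atom_nonzero by (auto simp: prod_list_zero_iff)
qed

lemma fully_reducible_nonzero:
  fixes f :: "'a::ring_1_no_zero_divisors"
  shows "fully_reducible f \<Longrightarrow> f \<noteq> 0"
  by (auto simp: fully_reducible_def dest: finite_length_nonzero)

section \<open>Comaximality and products\<close>

text \<open>As \<open>b * y\<close> is \<open>1\<close> modulo \<open>Ra\<close>, the coefficient in
  \<open>r = s * b\<close> satisfies \<open>s = r * y\<close> modulo \<open>Ra\<close>, so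
  \<open>s\<close> lies in \<open>Ra\<close> exactly when \<open>r * y\<close> does. The right-hand
  side is the annihilator of the pair of cosets of \<open>y\<close> and \<open>1\<close> in the
  direct sum of \<open>R/Ra\<close> and \<open>R/Rb\<close>.\<close>

lemma lideal_mult_eq_colon:
  assumes xy: "x * a + b * y = 1"
  shows "lideal (a * b) = {r. r * y \<in> lideal a \<and> r \<in> lideal b}"
proof (intro equalityI subsetI)
  fix r assume "r \<in> lideal (a * b)"
  then obtain s where s: "r = s * (a * b)" by (auto simp: mem_lideal)
  have "r * y = s * a * (1 - x * a)" by (simp add: s mult.assoc xy [symmetric])
  then have "r * y = (s - s * a * x) * a" by (simp add: algebra_simps)
  then show "r \<in> {r. r * y \<in> lideal a \<and> r \<in> lideal b}"
    unfolding s by (simp add: lideal_mult)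
next
  fix r assume r: "r \<in> {r. r * y \<in> lideal a \<and> r \<in> lideal b}"
  then obtain s where s: "r = s * b" by (auto simp: mem_lideal)
  then have "s = s * x * a + r * y" using xy by (metis distrib_left mult.assoc mult_1_right)
  moreover have "s * x * a + r * y \<in> lideal a" using r by (simp add: lideal_add lideal_mult)
  ultimately obtain t where "s = t * a" by (metis mem_lideal)
  then show "r \<in> lideal (a * b)" by (auto simp: s mem_lideal mult.assoc)
qed

text \<open>In terms of \<open>M = R/RL\<close>: the sequence \<open>0 \<rightarrow> R \<rightarrow> R\<^sup>2 \<rightarrow> R \<rightarrow> 0\<close> attached to \<open>q g = h p\<close> is
  split exact, so \<open>qM \<inter> hM = qgM\<close>.\<close>

lemma comaximal_inter:
  fixes L :: "'a::ring_1_no_zero_divisors"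
  assumes eq: "q * g = h * p" and nz: "g \<noteq> 0" "p \<noteq> 0"
    and cop: "c * g + e * p = 1" and int: "lideal g \<inter> lideal p = lideal (q * g)"
    and q: "1 \<in> lideal L + rideal q" and h: "1 \<in> lideal L + rideal h"
  shows "1 \<in> lideal L + rideal (q * g)"
proof -
  have "g * (c * g + e * p) = g" by (simp add: cop)
  then have 1: "(1 - g * c) * g = g * e * p" by (simp add: algebra_simps)
  \<comment> \<open>The element also equals \<open>g * e * p\<close>. Writing it as
    \<open>\<alpha> * q * g = \<alpha> * h * p\<close> and cancelling \<open>g\<close> or
    \<open>p\<close> gives both identities for \<open>\<alpha>\<close>.\<close>
  then have "(1 - g * c) * g \<in> lideal g \<inter> lideal p" by (metis IntI mem_lideal)
  then have "(1 - g * c) * g \<in> lideal (q * g)" by (simp only: int)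
  then obtain \<alpha> where "(1 - g * c) * g = \<alpha> * (q * g)" by (auto simp: mem_lideal)
  then have "(1 - g * c) * g = \<alpha> * q * g" "g * e * p = \<alpha> * h * p"
    using 1 eq by (simp_all add: mult.assoc)
  then have \<alpha>: "1 - g * c = \<alpha> * q" "g * e = \<alpha> * h" using nz mult_right_cancel by blast+
  from q obtain x u where u: "1 = x * L + q * u" by (auto simp: mem_lideal_plus_rideal)
  from h obtain y v where v: "1 = y * L + h * v" by (auto simp: mem_lideal_plus_rideal)
  \<comment> \<open>Modulo \<open>RL\<close>, \<open>q * u\<close> and \<open>h * v\<close> agree.
    The splitting \<open>(c, e)\<close> turns this into \<open>u = g * w\<close> modulo
    \<open>RL\<close>, whence \<open>q * g * w = q * u = 1\<close> modulo \<open>RL\<close>.\<close>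
  define w where "w = c * u + e * v"
  have "q * u - h * v = (y - x) * L" using u v by (simp add: algebra_simps)
  moreover have "u - g * w = \<alpha> * (q * u - h * v)"
  proof -
    have "u - g * w = (1 - g * c) * u - (g * e) * v" by (simp add: w_def algebra_simps)
    then show ?thesis unfolding \<alpha> by (simp add: algebra_simps)
  qed
  ultimately have w: "q * (u - g * w) = q * \<alpha> * (y - x) * L" by (simp add: mult.assoc)
  have "1 = x * L + (q * (u - g * w) + q * g * w)" using u by (simp add: algebra_simps)
  also have "\<dots> = (x + q * \<alpha> * (y - x)) * L + q * g * w"
    unfolding w by (simp add: algebra_simps)
  finally have "1 = (x + q * \<alpha> * (y - x)) * L + q * g * w" .
  then show ?thesis by (auto simp: mem_lideal_plus_rideal)
qed

section \<open>Left ideals and atoms in a 2-fir\<close>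

context
  assumes fir: "two_fir TYPE('a::ring_1_no_zero_divisors)"
begin

text \<open>Left-right symmetry of the 2-fir condition: in \<open>ra = sb \<noteq> 0\<close> cancel a generator of
  \<open>rR + sR\<close>, so that \<open>r'x + s'y = 1\<close>. The split exact sequence \<open>R \<rightarrow> R\<^sup>2 \<rightarrow> R\<close> given by
  \<open>(r', s')\<close> then turns right comaximality of \<open>r', s'\<close> into left comaximality of the cofactors
  \<open>a0, b0\<close>.\<close>

lemma two_fir_left:
  fixes a b :: 'a
  assumes "m \<in> lideal a" "m \<in> lideal b" "m \<noteq> 0"
  shows "\<exists>c d. lideal a \<inter> lideal b = lideal c \<and> lideal a + lideal b = lideal d"
proof -
  obtain r s where m: "m = r * a" "m = s * b" using assms by (metis mem_lideal)
  then have "m \<in> rideal r \<inter> rideal s" by (metis IntI mem_rideal)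
  then have "rideal r \<inter> rideal s \<noteq> {0}" using assms by blast
  then obtain n d where n: "rideal r \<inter> rideal s = rideal n"
    and d: "rideal r + rideal s = rideal d"
    using fir unfolding two_fir_def by metis
  have "r \<in> rideal d" "s \<in> rideal d"
    unfolding d [symmetric] mem_rideal_plus
    by (metis mult_1_right mult_zero_right add_0_right, metis mult_1_right mult_zero_right add_0_left)
  then obtain r' s' where r': "r = d * r'" and s': "s = d * s'" by (auto simp: mem_rideal)
  have nz: "r \<noteq> 0" "s \<noteq> 0" "a \<noteq> 0" "b \<noteq> 0" using m assms by auto
  then have "d \<noteq> 0" using r' by auto
  have "d \<in> rideal r + rideal s" unfolding d mem_rideal by (metis mult_1_right)
  then obtain x y where "d = r * x + s * y" by (auto simp: mem_rideal_plus)
  then have "d * (r' * x + s' * y) = d * 1" by (simp add: r' s' distrib_left mult.assoc)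
  then have xy: "r' * x + s' * y = 1" using \<open>d \<noteq> 0\<close> mult_left_cancel by blast
  have "n \<in> rideal r \<inter> rideal s" unfolding n mem_rideal by (metis mult_1_right)
  then obtain a0 b0 where n_a0: "n = r * a0" and n_b0: "n = s * b0" by (metis Int_iff mem_rideal)
  \<comment> \<open>Solutions are right multiples of \<open>(a0, b0)\<close> because
    \<open>r * a0 = s * b0\<close> generates the intersection of \<open>rR\<close> and
    \<open>sR\<close>.\<close>
  have param: "\<exists>c. u = a0 * c \<and> v = b0 * c" if "r' * u = s' * v" for u v
  proof -
    have "r * u = s * v" using that by (simp add: r' s' mult.assoc)
    then have "r * u \<in> rideal r \<inter> rideal s" by (metis IntI mem_rideal)
    then have "r * u \<in> rideal n" by (simp only: n)
    then obtain c where "r * u = n * c" by (auto simp: mem_rideal)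
    then have "r * u = r * (a0 * c)" "s * v = s * (b0 * c)"
      using \<open>r * u = s * v\<close> by (metis n_a0 mult.assoc, metis n_b0 mult.assoc)
    then show ?thesis using nz mult_left_cancel by blast
  qed
  have "d * (r' * a) = d * (s' * b)" by (metis m r' s' mult.assoc)
  then have ab: "r' * a = s' * b" using \<open>d \<noteq> 0\<close> mult_left_cancel by blast
  obtain t where t: "a = a0 * t" "b = b0 * t" using param [OF ab] by blast
  then have nz': "a0 \<noteq> 0" "b0 \<noteq> 0" "t \<noteq> 0" using nz by auto
  have "d * (r' * a0) = d * (s' * b0)" by (metis n_a0 n_b0 r' s' mult.assoc)
  then have a0b0: "r' * a0 = s' * b0" using \<open>d \<noteq> 0\<close> mult_left_cancel by blast
  \<comment> \<open>\<open>(1 - x * r', y * r')\<close> and, below,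
    \<open>(x * s', 1 - y * s')\<close> are the columns of the projection onto the kernel of the row
    \<open>(r', -s')\<close>, which is split by the column \<open>(x, -y)\<close>.\<close>
  have "r' * (1 - x * r') = s' * (y * r')"
  proof -
    have "(r' * x + s' * y) * r' = r'" by (simp add: xy)
    then show ?thesis by (simp add: algebra_simps)
  qed
  then obtain c where c: "1 - x * r' = a0 * c" "y * r' = b0 * c" using param by blast
  have "r' * (x * s') = s' * (1 - y * s')"
  proof -
    have "(r' * x + s' * y) * s' = s'" by (simp add: xy)
    then show ?thesis by (simp add: algebra_simps)
  qed
  then obtain e where e: "x * s' = a0 * e" "1 - y * s' = b0 * e" using param by blast
  have ce: "c * a0 + e * b0 = 1"
  proof -
    have "a0 * (c * a0) = (1 - x * r') * a0" by (simp add: c mult.assoc)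
    also have "\<dots> = a0 - x * (s' * b0)" by (simp add: algebra_simps a0b0)
    also have "x * (s' * b0) = a0 * (e * b0)" by (metis e(1) mult.assoc)
    finally have "a0 * (c * a0 + e * b0) = a0 * 1" by (simp add: algebra_simps)
    then show ?thesis using nz' mult_left_cancel by blast
  qed
  have "lideal a \<inter> lideal b = lideal (r' * a)"
  proof (intro equalityI subsetI)
    fix z assume "z \<in> lideal a \<inter> lideal b"
    then obtain u v where z: "z = u * a" "z = v * b" by (metis Int_iff mem_lideal)
    then have "u * a0 * t = v * b0 * t" by (metis t mult.assoc)
    then have uv: "u * a0 = v * b0" using nz' mult_right_cancel by blast
    \<comment> \<open>The row \<open>(u, -v)\<close> kills \<open>(a0, b0)\<close>, hence the image
      of that projection, so it is \<open>u * x + v * y\<close> times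
      \<open>(r', -s')\<close>.\<close>
    have "(u * x + v * y) * r' = u - u * (1 - x * r') + v * (y * r')"
      by (simp add: algebra_simps)
    also have "\<dots> = u - (u * a0) * c + (v * b0) * c" by (simp add: c mult.assoc)
    finally have "u = (u * x + v * y) * r'" by (simp add: uv)
    then show "z \<in> lideal (r' * a)" using z by (metis mem_lideal mult.assoc)
  next
    fix z assume "z \<in> lideal (r' * a)"
    then show "z \<in> lideal a \<inter> lideal b"
      by (metis Int_iff ab lideal_mult lideal_self mem_lideal)
  qed
  moreover have "lideal a + lideal b = lideal t"
  proof (intro equalityI subsetI)
    fix z assume "z \<in> lideal a + lideal b"
    then obtain u v where "z = u * a + v * b" by (auto simp: mem_lideal_plus)
    then have "z = (u * a0 + v * b0) * t" by (simp add: t algebra_simps)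
    then show "z \<in> lideal t" by (auto simp: mem_lideal)
  next
    fix z assume "z \<in> lideal t"
    then obtain w where "z = w * t" by (auto simp: mem_lideal)
    also have "\<dots> = w * (c * a0 + e * b0) * t" by (simp add: ce)
    finally have "z = (w * c) * a + (w * e) * b" by (simp add: t algebra_simps)
    then show "z \<in> lideal a + lideal b" by (auto simp: mem_lideal_plus)
  qed
  ultimately show ?thesis by blast
qed

text \<open>The common multiple \<open>m\<close> makes \<open>Rg + Rp\<close> principal. Its
  generator is a right factor of the atom \<open>p\<close>, so it is a unit or generates
  \<open>Rp\<close>, and the latter would put \<open>g\<close> into \<open>Rp\<close>.\<close>

lemma atom_comaximal:
  fixes p :: 'a
  assumes p: "p \<in> atoms" and m: "m \<in> lideal g" "m \<in> lideal p" "m \<noteq> 0"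
    and g: "g \<notin> lideal p"
  shows "\<exists>r s. r * g + s * p = 1"
proof -
  obtain d where d: "lideal g + lideal p = lideal d" using two_fir_left [OF m] by blast
  have "g \<in> lideal d" "p \<in> lideal d"
    unfolding d [symmetric] mem_lideal_plus
    by (metis mult_1_left mult_zero_left add_0_right, metis mult_1_left mult_zero_left add_0_left)
  then obtain x where x: "p = x * d" by (auto simp: mem_lideal)
  have "x \<notin> ring_units"
  proof
    assume "x \<in> ring_units"
    then obtain y where "y * x = 1" by (auto simp: ring_units_def)
    then have "d = y * p" by (simp add: x mult.assoc [symmetric])
    then have "lideal d \<subseteq> lideal p" by (metis lideal_subset_iff mem_lideal)
    then show False using g \<open>g \<in> lideal d\<close> by blast
  qed
  then have "d \<in> ring_units" using p x unfolding atoms_def by blast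
  then have "1 \<in> lideal g + lideal p" by (simp add: d lideal_UNIV_iff [THEN iffD2])
  then show ?thesis by (metis mem_lideal_plus)
qed

text \<open>Right multiplication by \<open>g\<close> induces an isomorphism of \<open>R/Rq\<close>
  with \<open>R/Rp\<close>, and being an atom transfers along it. In elements: if
  \<open>q = x * y\<close>, then either \<open>y * g\<close> lies in \<open>Rp\<close>, which makes
  \<open>x\<close> a unit, or it is comaximal with \<open>p\<close>, which makes \<open>y\<close> a
  unit.\<close>

lemma transpose_atom:
  fixes p :: 'a
  assumes p: "p \<in> atoms" and nz: "q * g \<noteq> 0"
    and cop: "r * g + s * p = 1" and int: "lideal g \<inter> lideal p = lideal (q * g)"
  shows "q \<in> atoms"
proof -
  have "g \<noteq> 0" "q \<noteq> 0" using nz by auto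
  have qg: "q * g \<in> lideal p" using int by (metis Int_iff lideal_self)
  have "q \<notin> ring_units"
  proof
    assume "q \<in> ring_units"
    then obtain v where "v * q = 1" by (auto simp: ring_units_def)
    then have "g \<in> lideal p" using lideal_mult [OF qg, of v] by (simp add: mult.assoc [symmetric])
    then have "1 \<in> lideal p" by (metis cop lideal_add lideal_mult lideal_self)
    then show False using atom_nonunit [OF p]
      by (metis lideal_subset_iff lideal_one lideal_UNIV_iff top.extremum_unique)
  qed
  moreover have "x \<in> ring_units \<or> y \<in> ring_units" if q: "q = x * y" for x y
  proof (cases "y * g \<in> lideal p")
    case True
    then have "y * g \<in> lideal (q * g)" using int by (metis Int_iff lideal_mult lideal_self)
    then obtain t where "y * g = t * x * y * g" by (auto simp: mem_lideal q mult.assoc)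
    then have "1 * y = t * x * y" using \<open>g \<noteq> 0\<close> mult_right_cancel by (metis mult_1_left)
    then have "t * x = 1" using \<open>q \<noteq> 0\<close> q mult_right_cancel by (metis mult_zero_right)
    then show ?thesis using left_inverse_imp_unit by blast
  next
    case False
    have "q * g \<in> lideal (y * g)" by (auto simp: mem_lideal q mult.assoc)
    from atom_comaximal [OF p this qg nz False]
    obtain t u where tu: "t * (y * g) + u * p = 1" by blast
    have "g * (t * (y * g) + u * p) = g" by (simp add: tu)
    then have "(1 - g * t * y) * g = g * u * p" by (simp add: algebra_simps)
    then have "(1 - g * t * y) * g \<in> lideal g \<inter> lideal p" by (metis IntI mem_lideal)
    then have "(1 - g * t * y) * g \<in> lideal (q * g)" by (simp only: int)
    then obtain w where "(1 - g * t * y) * g = w * x * y * g"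
      by (auto simp: mem_lideal q mult.assoc)
    then have "1 - g * t * y = w * x * y" using \<open>g \<noteq> 0\<close> mult_right_cancel by blast
    then have "(w * x + g * t) * y = 1" by (simp add: algebra_simps)
    then show ?thesis using left_inverse_imp_unit by blast
  qed
  ultimately show ?thesis using \<open>q \<noteq> 0\<close> by (auto simp: atoms_def)
qed

lemma inter_principal:
  fixes f :: 'a
  assumes "finite P" "f \<noteq> 0" "\<forall>p\<in>P. f \<in> lideal p"
  shows "\<exists>g. (\<Inter>p\<in>P. lideal p) = lideal g"
  using assms(1,3)
proof (induction P)
  case empty
  show ?case by (metis lideal_one INT_empty)
next
  case (insert p P)
  then obtain g where g: "(\<Inter>p\<in>P. lideal p) = lideal g" by auto
  have "f \<in> lideal p" using insert.prems by blast
  moreover have "f \<in> lideal g" using insert.prems unfolding g [symmetric] by blast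
  ultimately obtain c where "lideal p \<inter> lideal g = lideal c"
    using two_fir_left assms(2) by blast
  then show ?case using g by auto
qed

text \<open>The induction step for intersections of atoms: \<open>Rp\<close> is either redundant, or
  it contributes to \<open>f\<close> an atomic left factor \<open>q\<close> that is a transpose of
  \<open>p\<close>.\<close>

lemma inter_atom_cases:
  fixes f :: 'a
  assumes f: "f \<noteq> 0" "lideal f = lideal p \<inter> lideal g" and p: "p \<in> atoms"
  obtains "lideal f = lideal g"
  | q h c e where "f = q * g" "f = h * p" "q \<in> atoms" "c * g + e * p = 1"
proof (cases "g \<in> lideal p")
  case True
  then show ?thesis using f that(1) by (metis lideal_subset_iff inf.absorb_iff2)
next
  case False
  have fg: "f \<in> lideal g" "f \<in> lideal p" using f(2) by (metis Int_iff lideal_self)+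
  then obtain q h where qh: "f = q * g" "f = h * p" by (metis mem_lideal)
  obtain c e where ce: "c * g + e * p = 1" using atom_comaximal [OF p fg f(1) False] by blast
  have "q \<in> atoms" by (rule transpose_atom [OF p _ ce]) (use f qh in auto)
  then show ?thesis using that(2) qh ce by blast
qed

text \<open>Finite length is automatic: a further atom either leaves the intersection unchanged or
  multiplies its generator on the left by an atom.\<close>

lemma fully_reducibleI:
  fixes f :: 'a
  assumes "f \<noteq> 0" "finite P" "P \<subseteq> atoms" "lideal f = (\<Inter>p\<in>P. lideal p)"
  shows "fully_reducible f"
proof -
  have "f \<in> finite_length" using assms(2,1,3,4)
  proof (induction P arbitrary: f)
    case empty
    then show ?case by (simp add: lideal_UNIV_iff finite_length_iff)
  next
    case (insert p P)
    have "\<forall>x\<in>insert p P. f \<in> lideal x" using insert.prems(3) by (metis INT_iff lideal_self)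
    then obtain g where g: "(\<Inter>p\<in>P. lideal p) = lideal g"
      using inter_principal insert by (metis insert_iff)
    have p: "p \<in> atoms" "P \<subseteq> atoms" using insert.prems by auto
    have fpg: "lideal f = lideal p \<inter> lideal g" using insert.prems g by simp
    from insert.prems(1) fpg p(1) show ?case
    proof (cases rule: inter_atom_cases)
      case 1
      then show ?thesis using insert.IH insert.prems(1) p g by simp
    next
      case (2 q h c e)
      then have "g \<noteq> 0" using insert.prems by auto
      then have "g \<in> finite_length" using insert.IH p g by simp
      then consider "g \<in> ring_units" | n where "prod_of_atoms n g" by (auto simp: finite_length_iff)
      then show ?thesis
      proof cases
        case 1
        \<comment> \<open>A unit \<open>g\<close> need not be a product of atoms, so
          \<open>f\<close> is shown to be an atom itself: here \<open>Rf = Rp\<close>, and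
          \<open>f\<close> is the transpose of \<open>p\<close> along \<open>1\<close>.\<close>
        then have "lideal 1 \<inter> lideal p = lideal (f * 1)" using fpg by (auto simp: lideal_UNIV_iff [THEN iffD2])
        moreover have "1 * 1 + 0 * p = 1" by simp
        ultimately have "f \<in> atoms" using transpose_atom [OF p(1)] insert.prems(1) by (metis mult_1_right)
        then show ?thesis by (rule atom_finite_length)
      next
        case 2
        then obtain ps where "set ps \<subseteq> atoms" "g = prod_list ps" by (auto simp: prod_of_atoms_def)
        then have "set (q # ps) \<subseteq> atoms" "f = prod_list (q # ps)"
          using \<open>q \<in> atoms\<close> \<open>f = q * g\<close> by auto
        then show ?thesis unfolding finite_length_iff prod_of_atoms_def by blast
      qed
    qed
  qed
  then show ?thesis using assms by (auto simp: fully_reducible_def)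
qed

section \<open>Colon ideals of fully reducible elements\<close>

text \<open>If \<open>y\<close> is not in \<open>Rp\<close>, the colon ideal is \<open>Rq\<close>,
  where \<open>q * y\<close> generates the intersection of \<open>Ry\<close> and \<open>Rp\<close>,
  and \<open>q\<close> is a transpose of \<open>p\<close>. The nonzero element \<open>z\<close> of
  the colon ideal makes that intersection nonzero, hence principal.\<close>

lemma colon_atom:
  fixes p :: 'a
  assumes p: "p \<in> atoms" and z: "z \<noteq> 0" "z * y \<in> lideal p"
  shows "{r. r * y \<in> lideal p} = UNIV \<or> (\<exists>q\<in>atoms. {r. r * y \<in> lideal p} = lideal q)"
proof (cases "y \<in> lideal p")
  case True
  then show ?thesis by (auto simp: lideal_mult)
next
  case False
  then have "y \<noteq> 0" by auto
  then have zy: "z * y \<noteq> 0" using z by simp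
  have zy': "z * y \<in> lideal y" by (auto simp: mem_lideal)
  obtain r s where rs: "r * y + s * p = 1" using atom_comaximal [OF p zy' z(2) zy False] by blast
  obtain c where c: "lideal y \<inter> lideal p = lideal c" using two_fir_left [OF zy' z(2) zy] by blast
  then obtain q where q: "c = q * y" by (metis Int_iff lideal_self mem_lideal)
  have "z * y \<in> lideal c" using c zy' z(2) by blast
  then have "c \<noteq> 0" using zy by (auto simp: mem_lideal)
  then have "q \<in> atoms" using transpose_atom p rs c q by blast
  moreover have "{r. r * y \<in> lideal p} = lideal q"
  proof (intro equalityI subsetI)
    fix t assume "t \<in> {r. r * y \<in> lideal p}"
    then have "t * y \<in> lideal y \<inter> lideal p" by (simp add: lideal_mult)
    then have "t * y \<in> lideal c" by (simp only: c)
    then obtain w where "t * y = w * q * y" by (auto simp: mem_lideal q mult.assoc)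
    then show "t \<in> lideal q" using \<open>y \<noteq> 0\<close> by (auto simp: mem_lideal)
  next
    fix t assume "t \<in> lideal q"
    then have "t * y \<in> lideal c" by (auto simp: mem_lideal q mult.assoc)
    then show "t \<in> {r. r * y \<in> lideal p}" using c by blast
  qed
  ultimately show ?thesis by blast
qed

text \<open>Colon ideals commute with intersections, so each atom is treated separately. The bound
  on \<open>card Q\<close> serves the induction in \<open>comaximal_of_atoms\<close>.\<close>

lemma colon_inter:
  fixes y :: 'a
  assumes "finite P" "P \<subseteq> atoms" "z \<noteq> 0" "\<forall>p\<in>P. z * y \<in> lideal p"
  shows "\<exists>Q. finite Q \<and> Q \<subseteq> atoms \<and> card Q \<le> card P \<and>
    {r. \<forall>p\<in>P. r * y \<in> lideal p} = (\<Inter>q\<in>Q. lideal q)"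
  using assms(1,2,4)
proof (induction P)
  case empty
  show ?case by (auto intro!: exI [of _ "{}"])
next
  case (insert p P)
  then obtain Q where Q: "finite Q" "Q \<subseteq> atoms" "card Q \<le> card P"
    "{r. \<forall>p\<in>P. r * y \<in> lideal p} = (\<Inter>q\<in>Q. lideal q)" by auto
  have eq: "{r. \<forall>x\<in>insert p P. r * y \<in> lideal x} =
      {r. r * y \<in> lideal p} \<inter> {r. \<forall>p\<in>P. r * y \<in> lideal p}" by auto
  have "{r. r * y \<in> lideal p} = UNIV \<or> (\<exists>q\<in>atoms. {r. r * y \<in> lideal p} = lideal q)"
    using insert.prems assms(3) by (intro colon_atom) auto
  then show ?case
  proof (elim disjE bexE)
    assume "{r. r * y \<in> lideal p} = UNIV"
    then show ?thesis using eq Q insert.hyps by (intro exI [of _ Q]) auto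
  next
    fix q assume q: "q \<in> atoms" "{r. r * y \<in> lideal p} = lideal q"
    have "card (insert q Q) \<le> card (insert p P)"
      using Q insert.hyps by (metis card_insert_disjoint card_insert_le_m1 diff_Suc_1 le_SucI
          not_less_eq_eq zero_less_Suc card_insert_if)
    then show ?thesis using eq Q q by (intro exI [of _ "insert q Q"]) auto
  qed
qed

lemma fully_reducible_colon:
  fixes f g :: 'a
  assumes f: "fully_reducible f" and g: "g \<noteq> 0" "lideal g = {r. r * y \<in> lideal f}"
  shows "fully_reducible g"
proof -
  obtain P where P: "finite P" "P \<subseteq> atoms" "lideal f = (\<Inter>p\<in>P. lideal p)"
    using f by (auto simp: fully_reducible_def)
  have "g * y \<in> lideal f" using g(2) by (metis lideal_self mem_Collect_eq)
  then have gP: "\<forall>p\<in>P. g * y \<in> lideal p" using P by auto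
  obtain Q where "finite Q" "Q \<subseteq> atoms"
    "{r. \<forall>p\<in>P. r * y \<in> lideal p} = (\<Inter>q\<in>Q. lideal q)"
    using colon_inter [OF P(1,2) g(1) gP] by blast
  then show ?thesis using g P by (intro fully_reducibleI [of g Q]) auto
qed

lemma fully_reducible_INT:
  fixes h :: 'a
  assumes "finite F" "\<forall>f\<in>F. fully_reducible f" "h \<noteq> 0" "lideal h = (\<Inter>f\<in>F. lideal f)"
  shows "fully_reducible h"
proof -
  obtain P where P: "\<forall>f\<in>F. finite (P f) \<and> P f \<subseteq> atoms \<and> lideal f = (\<Inter>p\<in>P f. lideal p)"
    using assms(2) unfolding fully_reducible_def by metis
  show ?thesis
    by (rule fully_reducibleI [of h "\<Union>f\<in>F. P f"]) (use assms P in auto)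
qed

text \<open>The ideal is the annihilator of a pair of cosets in the direct sum of
  \<open>R/Rf\<close> and \<open>R/Rg\<close>. Both comaximality and a module isomorphism present
  \<open>Rab\<close> in this form.\<close>

lemma colon_pair_inter:
  fixes f g h :: 'a
  assumes f: "fully_reducible f" and g: "fully_reducible g" and h: "h \<noteq> 0"
    and eq: "lideal h = {r. r * x \<in> lideal f \<and> r * y \<in> lideal g}"
  shows "fully_reducible h"
proof -
  obtain P where P: "finite P" "P \<subseteq> atoms" "lideal f = (\<Inter>p\<in>P. lideal p)"
    using f by (auto simp: fully_reducible_def)
  obtain Q where Q: "finite Q" "Q \<subseteq> atoms" "lideal g = (\<Inter>q\<in>Q. lideal q)"
    using g by (auto simp: fully_reducible_def)
  have "h * x \<in> lideal f" "h * y \<in> lideal g" using eq by (metis (lifting) lideal_self mem_Collect_eq)+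
  then have "\<forall>p\<in>P. h * x \<in> lideal p" "\<forall>q\<in>Q. h * y \<in> lideal q" using P Q by auto
  then obtain P' Q' where PQ': "finite P'" "P' \<subseteq> atoms" "finite Q'" "Q' \<subseteq> atoms"
    "{r. \<forall>p\<in>P. r * x \<in> lideal p} = (\<Inter>q\<in>P'. lideal q)"
    "{r. \<forall>q\<in>Q. r * y \<in> lideal q} = (\<Inter>q\<in>Q'. lideal q)"
    using colon_inter [OF P(1,2) h] colon_inter [OF Q(1,2) h] by meson
  have "lideal h = {r. \<forall>p\<in>P. r * x \<in> lideal p} \<inter> {r. \<forall>q\<in>Q. r * y \<in> lideal q}"
    using eq P Q by auto
  then show ?thesis using h PQ' by (intro fully_reducibleI [of h "P' \<union> Q'"]) auto
qed

section \<open>Complements and factors of fully reducible elements\<close>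

text \<open>As in a semisimple module: among the subfamilies of \<open>P\<close> whose intersection
  \<open>Rz\<close> is comaximal with \<open>Rb\<close>, a maximal one also has \<open>Rz\<close>
  meeting \<open>Rb\<close> only in \<open>Rf\<close>.\<close>

lemma complement:
  fixes f b :: 'a
  assumes f: "fully_reducible f" and fb: "f \<in> lideal b"
  shows "\<exists>z u v. u * b + v * z = 1 \<and> lideal b \<inter> lideal z = lideal f"
proof -
  obtain P where P: "finite P" "P \<subseteq> atoms" "lideal f = (\<Inter>p\<in>P. lideal p)"
    using f by (auto simp: fully_reducible_def)
  have f0: "f \<noteq> 0" using f by (rule fully_reducible_nonzero)
  have fP: "\<forall>p\<in>P. f \<in> lideal p" using P(3) by (metis INT_iff lideal_self)
  let ?good = "\<lambda>J. J \<subseteq> P \<and> (\<exists>z. lideal z = (\<Inter>p\<in>J. lideal p) \<and> 1 \<in> lideal b + lideal z)"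
  have "1 = 0 * b + 1 * 1" by simp
  then have "1 \<in> lideal b + lideal 1" unfolding mem_lideal_plus by blast
  then have "?good {}" by (auto intro!: exI [of _ 1])
  moreover have "finite {J. ?good J}" by (rule finite_subset [of _ "Pow P"]) (use P in auto)
  ultimately obtain J where J: "?good J" and max: "\<And>J'. ?good J' \<Longrightarrow> J \<subseteq> J' \<Longrightarrow> J = J'"
    using finite_has_maximal2 [of "{J. ?good J}" "{}"] by auto
  then obtain z where z: "lideal z = (\<Inter>p\<in>J. lideal p)" "1 \<in> lideal b + lideal z" and JP: "J \<subseteq> P"
    by blast
  have fz: "f \<in> lideal z" using z fP JP by auto
  obtain k where k: "lideal b \<inter> lideal z = lideal k" using two_fir_left [OF fb fz f0] by blast
  have fk: "f \<in> lideal k" using k fb fz by blast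
  have kp: "k \<in> lideal p" if p: "p \<in> P" for p
  proof (rule ccontr)
    assume nk: "k \<notin> lideal p"
    obtain r s where rs: "r * k + s * p = 1"
      using atom_comaximal [OF _ fk _ f0 nk] p fP P by blast
    obtain z' where z': "lideal z \<inter> lideal p = lideal z'"
      using two_fir_left [OF fz _ f0] p fP by blast
    have k': "k \<in> lideal b" "k \<in> lideal z" using k by (metis Int_iff lideal_self)+
    \<comment> \<open>If \<open>k\<close> is not in \<open>Rp\<close>, then \<open>p\<close> can be
      added to \<open>J\<close>: in this decomposition of \<open>z\<close> the first summand lies in
      \<open>Rb\<close> and the second in \<open>Rz'\<close>, so \<open>Rb + Rz'\<close> still
      contains \<open>1\<close>.\<close>
    have "z * (r * k) + z * (s * p) = z" using rs by (metis distrib_left mult_1_right)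
    then have "z * (s * p) = z - z * (r * k)" by (simp add: algebra_simps)
    then have "z * (s * p) \<in> lideal z" using k' by (simp add: lideal_diff lideal_mult)
    then have "z * (s * p) \<in> lideal z \<inter> lideal p" by (simp add: lideal_mult)
    then have "z * (s * p) \<in> lideal z'" by (simp only: z')
    then obtain t where t: "z * (s * p) = t * z'" by (auto simp: mem_lideal)
    obtain u v where uv: "1 = u * b + v * z" using z(2) by (auto simp: mem_lideal_plus)
    obtain w where w: "k = w * b" using k' by (auto simp: mem_lideal)
    have "1 = u * b + v * (z * (r * k) + z * (s * p))"
      using uv \<open>z * (r * k) + z * (s * p) = z\<close> by simp
    also have "\<dots> = (u + v * z * r * w) * b + (v * t) * z'"
      by (simp add: t w algebra_simps)
    finally have "1 \<in> lideal b + lideal z'" by (auto simp: mem_lideal_plus)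
    moreover have "lideal z' = (\<Inter>p\<in>insert p J. lideal p)" using z z' by auto
    ultimately have "J = insert p J" using max [of "insert p J"] p JP by blast
    then have "lideal z \<subseteq> lideal p" using z by blast
    then show False using nk k' by blast
  qed
  then have "k \<in> lideal f" unfolding P(3) by blast
  then have "lideal k \<subseteq> lideal f" by (simp add: lideal_subset_iff)
  then have "lideal b \<inter> lideal z = lideal f" using k fk by (simp add: lideal_subset_iff subset_antisym)
  then show ?thesis using z(2) by (metis mem_lideal_plus)
qed

lemma fully_reducible_left_factor:
  fixes x y :: 'a
  assumes "fully_reducible (x * y)"
  shows "fully_reducible x"
proof -
  have "x \<noteq> 0" "y \<noteq> 0" using fully_reducible_nonzero [OF assms] by auto
  then have "lideal x = {r. r * y \<in> lideal (x * y)}"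
    by (auto simp: mem_lideal mult.assoc [symmetric])
  then show ?thesis using fully_reducible_colon [OF assms \<open>x \<noteq> 0\<close>] by blast
qed

text \<open>A quotient of a semisimple module embeds back into it: if \<open>Rz\<close> is a
  complement of \<open>Ry\<close> and \<open>u * y + v * z = 1\<close>, then \<open>r\<close> lies
  in \<open>Ry\<close> exactly when \<open>r * (v * z)\<close> lies in \<open>Rxy\<close>.\<close>

lemma fully_reducible_right_factor:
  fixes x y :: 'a
  assumes "fully_reducible (x * y)"
  shows "fully_reducible y"
proof -
  have nz: "x \<noteq> 0" "y \<noteq> 0" using fully_reducible_nonzero [OF assms] by auto
  have "x * y \<in> lideal y" by (auto simp: mem_lideal)
  then obtain z u v where uv: "u * y + v * z = 1" and z: "lideal y \<inter> lideal z = lideal (x * y)"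
    using complement [OF assms] by blast
  have "lideal y = {r. r * (v * z) \<in> lideal (x * y)}"
  proof (intro equalityI subsetI)
    fix r
    have r: "r * (v * z) = r - r * u * y" using uv by (metis add_diff_cancel_left' mult.assoc mult_1_right right_diff_distrib)
    {
      assume "r \<in> lideal y"
      then have "r * (v * z) \<in> lideal y" unfolding r by (simp add: lideal_diff lideal_mult)
      then show "r \<in> {r. r * (v * z) \<in> lideal (x * y)}"
        unfolding z [symmetric] by (simp add: lideal_mult)
    next
      assume "r \<in> {r. r * (v * z) \<in> lideal (x * y)}"
      then have "r * (v * z) \<in> lideal y" using z by blast
      then have "r * (v * z) + r * u * y \<in> lideal y" by (simp add: lideal_add lideal_mult)
      then show "r \<in> lideal y" by (simp add: r)
    }
  qed
  then show ?thesis using fully_reducible_colon [OF assms nz(2)] by blast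
qed

text \<open>Besides giving (i) iff (iii), this is applied to \<open>p * q\<close> and
  \<open>p * b\<close> when (vi) is reduced to (iv).\<close>

lemma fully_reducible_mult_iff:
  fixes a b :: 'a
  shows "fully_reducible (a * b) \<longleftrightarrow>
    fully_reducible a \<and> fully_reducible b \<and> 1 \<in> lideal a + rideal b"
proof (intro iffI conjI)
  assume ab: "fully_reducible (a * b)"
  then show "fully_reducible a" "fully_reducible b"
    by (rule fully_reducible_left_factor, rule fully_reducible_right_factor)
  have "b \<noteq> 0" using fully_reducible_nonzero [OF ab] by auto
  have "a * b \<in> lideal b" by (auto simp: mem_lideal)
  then obtain z u v where uv: "u * b + v * z = 1" and z: "lideal b \<inter> lideal z = lideal (a * b)"
    using complement [OF ab] by blast
  have "b * (u * b + v * z) = b" by (simp add: uv)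
  then have "(1 - b * u) * b = b * v * z" by (simp add: algebra_simps)
  then have "(1 - b * u) * b \<in> lideal b \<inter> lideal z" by (metis IntI mem_lideal)
  then have "(1 - b * u) * b \<in> lideal (a * b)" by (simp only: z)
  then obtain w where "(1 - b * u) * b = w * a * b" by (auto simp: mem_lideal mult.assoc)
  then have "1 - b * u = w * a" using \<open>b \<noteq> 0\<close> mult_right_cancel by blast
  then have "1 = w * a + b * u" by (simp add: algebra_simps)
  then show "1 \<in> lideal a + rideal b" by (auto simp: mem_lideal_plus_rideal)
next
  assume *: "fully_reducible a \<and> fully_reducible b \<and> 1 \<in> lideal a + rideal b"
  then obtain x y where xy: "x * a + b * y = 1" by (metis mem_lideal_plus_rideal)
  have "a * b \<noteq> 0" using * fully_reducible_nonzero by auto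
  moreover have "lideal (a * b) = {r. r * y \<in> lideal a \<and> r * 1 \<in> lideal b}"
    using lideal_mult_eq_colon [OF xy] by simp
  ultimately show "fully_reducible (a * b)" using colon_pair_inter * by blast
qed

section \<open>Reduction to atoms and F-bases\<close>

text \<open>Right multiplication by \<open>b\<close> is injective and so commutes with nonempty
  intersections. For empty \<open>P\<close> the intersection would be \<open>R\<close> instead of
  \<open>Rb\<close>.\<close>

lemma fully_reducible_mult_of_atoms:
  fixes a b :: 'a
  assumes "a \<noteq> 0" "b \<noteq> 0" "finite P" "lideal a = (\<Inter>p\<in>P. lideal p)" "P \<noteq> {}"
    and fr: "\<forall>p\<in>P. fully_reducible (p * b)"
  shows "fully_reducible (a * b)"
proof -
  have cancel: "r * b \<in> lideal (c * b) \<longleftrightarrow> r \<in> lideal c" for r c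
    using assms(2) by (auto simp: mem_lideal mult.assoc [symmetric])
  have "lideal (a * b) = (\<Inter>f\<in>(\<lambda>p. p * b) ` P. lideal f)"
  proof (intro equalityI subsetI)
    fix r assume "r \<in> lideal (a * b)"
    then obtain s where r: "r = s * a * b" by (auto simp: mem_lideal mult.assoc)
    have "s * a \<in> lideal a" by (simp add: lideal_mult)
    then show "r \<in> (\<Inter>f\<in>(\<lambda>p. p * b) ` P. lideal f)" using r cancel assms(4) by auto
  next
    fix r assume r: "r \<in> (\<Inter>f\<in>(\<lambda>p. p * b) ` P. lideal f)"
    obtain p where "p \<in> P" using assms(5) by blast
    then obtain t where "r = t * (p * b)" using r by (auto simp: mem_lideal)
    then have rb: "r = t * p * b" by (simp add: mult.assoc)
    then have "t * p \<in> lideal a" unfolding assms(4) using r cancel by auto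
    then show "r \<in> lideal (a * b)" using rb cancel by blast
  qed
  then show ?thesis
    by (rule fully_reducible_INT [rotated 3]) (use assms in auto)
qed

text \<open>A smallest family of atoms representing \<open>Ra\<close> is an F-basis: if one of its
  atoms were dependent on the others, it would contain their intersection as an ideal and could be
  dropped.\<close>

lemma finite_F_basis:
  fixes a :: 'a
  assumes a: "fully_reducible a" "a \<notin> ring_units"
  shows "\<exists>B. finite B \<and> F_basis B (V a) \<and> lideal a = (\<Inter>p\<in>B. lideal p)"
proof -
  have a0: "a \<noteq> 0" using fully_reducible_nonzero a by blast
  let ?R = "\<lambda>P. finite P \<and> P \<subseteq> atoms \<and> lideal a = (\<Inter>p\<in>P. lideal p)"
  obtain P where "?R P" using a by (auto simp: fully_reducible_def)
  then obtain B where B: "?R B" and min: "\<And>B'. card B' < card B \<Longrightarrow> \<not> ?R B'"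
    using exists_least_iff [of "\<lambda>n. \<exists>P. card P = n \<and> ?R P"] by metis
  have aB: "a \<in> lideal p" if "p \<in> B" for p using B that by (metis INT_iff lideal_self)
  have alg: "F_algebraic D" if "D \<subseteq> V a" for D
  proof -
    have "a \<in> (\<Inter>\<delta>\<in>D. lideal \<delta>)" using that by (auto simp: V_def)
    moreover have "D \<subseteq> finite_length - ring_units"
      using that by (auto simp: V_def atom_finite_length atom_nonunit)
    ultimately show ?thesis using a0 by (auto simp: F_algebraic_def)
  qed
  have BV: "B \<subseteq> V a" using B aB by (auto simp: V_def)
  have "\<not> F_dependent \<delta> (B - {\<delta>})" if \<delta>: "\<delta> \<in> B" for \<delta>
  proof
    assume "F_dependent \<delta> (B - {\<delta>})"
    then obtain G where G: "finite G" "G \<subseteq> B - {\<delta>}"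
      and ne: "lideal \<delta> + (\<Inter>\<gamma>\<in>G. lideal \<gamma>) \<noteq> UNIV" by (auto simp: F_dependent_def)
    obtain g where g: "(\<Inter>\<gamma>\<in>G. lideal \<gamma>) = lideal g"
      using inter_principal [OF G(1) a0] G aB by blast
    have ag: "a \<in> lideal g" using G aB unfolding g [symmetric] by auto
    have "g \<in> lideal \<delta>"
    proof (rule ccontr)
      assume "g \<notin> lideal \<delta>"
      then obtain r s where rs: "r * g + s * \<delta> = 1"
        using atom_comaximal [OF _ ag aB [OF \<delta>] a0] \<delta> B by blast
      have "x = x * s * \<delta> + x * r * g" for x
        using rs by (metis add.commute distrib_left mult.assoc mult_1_right)
      then have "x \<in> lideal \<delta> + lideal g" for x unfolding mem_lideal_plus by blast
      then show False using ne g by auto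
    qed
    then have "(\<Inter>\<gamma>\<in>G. lideal \<gamma>) \<subseteq> lideal \<delta>" by (simp add: g lideal_subset_iff)
    moreover have "(\<Inter>p\<in>B - {\<delta>}. lideal p) \<subseteq> (\<Inter>\<gamma>\<in>G. lideal \<gamma>)"
      using G(2) by (rule INT_anti_mono) simp
    moreover have "(\<Inter>p\<in>B. lideal p) = lideal \<delta> \<inter> (\<Inter>p\<in>B - {\<delta>}. lideal p)"
      using \<delta> by auto
    ultimately have "lideal a = (\<Inter>p\<in>B - {\<delta>}. lideal p)" using B by auto
    moreover have "card (B - {\<delta>}) < card B" using B \<delta> by (metis card_Diff1_less)
    ultimately show False using min [of "B - {\<delta>}"] B by blast
  qed
  moreover have "F_dependent \<delta> B" if \<delta>: "\<delta> \<in> V a" for \<delta>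
  proof -
    have \<delta>': "\<delta> \<in> atoms" "a \<in> lideal \<delta>" using \<delta> by (auto simp: V_def)
    \<comment> \<open>The finite set \<open>B\<close> itself witnesses dependence: its intersection
      is \<open>Ra\<close>, which is contained in the proper ideal generated by
      \<open>\<delta>\<close>.\<close>
    have "1 \<notin> lideal \<delta> + lideal a"
    proof
      assume "1 \<in> lideal \<delta> + lideal a"
      then have "1 \<in> lideal \<delta>" using \<delta>' by (metis lideal_add lideal_mult lideal_self mem_lideal_plus)
      then show False using atom_nonunit [OF \<delta>'(1)] by (metis mem_lideal left_inverse_imp_unit)
    qed
    then have "lideal \<delta> + (\<Inter>\<gamma>\<in>B. lideal \<gamma>) \<noteq> UNIV" using B by auto
    then show ?thesis
      using alg [OF BV] alg [of "B \<union> {\<delta>}"] BV \<delta> \<delta>' B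
      by (auto simp: F_dependent_def atom_finite_length)
  qed
  ultimately have "F_basis B (V a)"
    using alg BV by (auto simp: F_basis_def F_independent_def)
  then show ?thesis using B by blast
qed

text \<open>Induction on the size of a family of atoms representing \<open>Rb\<close>. When
  \<open>b = q * g = h * p\<close>, the colon ideals by \<open>p\<close> of the remaining atoms
  represent \<open>Rh\<close> by a smaller family, and atomic left factors of \<open>h\<close> are
  left factors of \<open>b\<close>; \<open>comaximal_inter\<close> combines \<open>q\<close> and
  \<open>h\<close>.\<close>

lemma comaximal_of_atoms:
  fixes L b :: 'a
  assumes "fully_reducible b" and "\<forall>q\<in>V' b. 1 \<in> lideal L + rideal q"
  shows "1 \<in> lideal L + rideal b"
proof -
  obtain P where "finite P" "P \<subseteq> atoms" "lideal b = (\<Inter>p\<in>P. lideal p)"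
    using assms(1) by (auto simp: fully_reducible_def)
  then show ?thesis using assms(2) fully_reducible_nonzero [OF assms(1)]
  proof (induction "card P" arbitrary: P b rule: less_induct)
    case less
    show ?case
    proof (cases "P = {}")
      case True
      then have "b \<in> ring_units" using less.prems by (simp add: lideal_UNIV_iff)
      then obtain v where "1 = 0 * L + b * v" by (auto simp: ring_units_def)
      then show ?thesis unfolding mem_lideal_plus_rideal by blast
    next
      case False
      then obtain p where p: "p \<in> P" by blast
      define P' where "P' = P - {p}"
      have "card P' < card P" unfolding P'_def using less.prems(1) p by (rule card_Diff1_less)
      then have P': "finite P'" "P' \<subseteq> atoms" "P = insert p P'" "card P' < card P"
        using less.prems p by (auto simp: P'_def)
      have bP: "\<forall>x\<in>P. b \<in> lideal x" using less.prems(3) by (metis INT_iff lideal_self)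
      then obtain g where g: "(\<Inter>p\<in>P'. lideal p) = lideal g"
        using inter_principal [of P' b] P' less.prems by blast
      have "p \<in> atoms" using p less.prems by blast
      have int: "lideal b = lideal p \<inter> lideal g" using less.prems P' g by simp
      from less.prems(5) int \<open>p \<in> atoms\<close> show ?thesis
      proof (cases rule: inter_atom_cases)
        case 1
        then show ?thesis using less.hyps [OF P'(4,1,2)] g less.prems(4,5) by simp
      next
        case (2 q h c e)
        have nz: "g \<noteq> 0" "p \<noteq> 0" "h \<noteq> 0" using 2 less.prems(5) by auto
        have "lideal h = {r. \<forall>x\<in>P'. r * p \<in> lideal x}"
        proof -
          have "r \<in> lideal h \<longleftrightarrow> r * p \<in> lideal b" for r
            using nz by (auto simp: mem_lideal \<open>b = h * p\<close> mult.assoc [symmetric])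
          moreover have "r * p \<in> lideal b \<longleftrightarrow> (\<forall>x\<in>P'. r * p \<in> lideal x)" for r
            using less.prems(3) P'(3) by (auto simp: lideal_mult)
          ultimately show ?thesis by auto
        qed
        moreover have hp: "\<forall>x\<in>P'. h * p \<in> lideal x" using bP P' \<open>b = h * p\<close> by auto
        ultimately obtain Q where Q: "finite Q" "Q \<subseteq> atoms" "card Q \<le> card P'"
          "lideal h = (\<Inter>q\<in>Q. lideal q)"
          using colon_inter [OF P'(1,2) nz(3) hp] by auto
        have "V' h \<subseteq> V' b" by (auto simp: V'_def mem_rideal \<open>b = h * p\<close> mult.assoc)
        then have h1: "1 \<in> lideal L + rideal h"
          using less.hyps [of Q h] Q P' less.prems(4) nz by (meson le_less_trans subsetD)
        have "q \<in> V' b" using 2 by (auto simp: V'_def mem_rideal)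
        then have q1: "1 \<in> lideal L + rideal q" using less.prems(4) by blast
        have "lideal g \<inter> lideal p = lideal (q * g)" "q * g = h * p" using int 2 by auto
        then show ?thesis using comaximal_inter nz 2 q1 h1 by metis
      qed
    qed
  qed
qed

end

section \<open>Cyclic modules and direct sums\<close>

lemma coset_eq_iff:
  "x +o lideal a = y +o lideal a \<longleftrightarrow> x - y \<in> lideal a"
proof
  assume "x +o lideal a = y +o lideal a"
  moreover have "x \<in> x +o lideal a" by (auto simp: elt_set_plus_def intro!: bexI [of _ 0])
  ultimately show "x - y \<in> lideal a" by (auto simp: elt_set_plus_def)
next
  have *: "u +o lideal a \<subseteq> v +o lideal a" if "u - v \<in> lideal a" for u v
  proof
    fix z assume "z \<in> u +o lideal a"
    then obtain w where "w \<in> lideal a" "z = u + w" by (auto simp: elt_set_plus_def)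
    then have "z = v + (u - v + w)" "u - v + w \<in> lideal a"
      using that by (simp_all add: lideal_add)
    then show "z \<in> v +o lideal a" unfolding elt_set_plus_def by blast
  qed
  assume "x - y \<in> lideal a"
  moreover from this have "y - x \<in> lideal a" using lideal_diff [of 0 a "x - y"] by simp
  ultimately show "x +o lideal a = y +o lideal a" using * by blast
qed

lemma quot_lmodule_carrier: "lcarrier (quot_lmodule a) = range (\<lambda>x. x +o lideal a)"
  by (simp add: quot_lmodule_def)

text \<open>\<open>Rc\<close> is the annihilator of the coset of \<open>1\<close>, and an
  isomorphism preserves annihilators; \<open>x\<close> and \<open>y\<close> represent the two
  components of its image.\<close>

lemma quot_lmodule_iso_annihilator:
  assumes "lmodule_iso (quot_lmodule c) (lmodule_sum (quot_lmodule a) (quot_lmodule b))"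
  shows "\<exists>x y. lideal c = {r. r * x \<in> lideal a \<and> r * y \<in> lideal b}"
proof -
  obtain \<phi> where inj: "inj_on \<phi> (lcarrier (quot_lmodule c))"
    and im: "\<phi> ` lcarrier (quot_lmodule c) = lcarrier (lmodule_sum (quot_lmodule a) (quot_lmodule b))"
    and smult: "\<And>r x. x \<in> lcarrier (quot_lmodule c) \<Longrightarrow> \<phi> (lsmult (quot_lmodule c) r x) =
      lsmult (lmodule_sum (quot_lmodule a) (quot_lmodule b)) r (\<phi> x)"
    using assms unfolding lmodule_iso_def bij_betw_def by metis
  have "\<phi> (1 +o lideal c) \<in> lcarrier (lmodule_sum (quot_lmodule a) (quot_lmodule b))"
    unfolding im [symmetric] by (auto simp: quot_lmodule_carrier)
  then obtain x y where xy: "\<phi> (1 +o lideal c) = (x +o lideal a, y +o lideal b)"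
    by (auto simp: lmodule_sum_def quot_lmodule_carrier)
  have \<phi>: "\<phi> (r +o lideal c) = ((r * x) +o lideal a, (r * y) +o lideal b)" for r
    using smult [of "1 +o lideal c" r] xy
    by (simp add: quot_lmodule_lsmult lmodule_sum_def) (simp add: quot_lmodule_carrier)
  have mem: "r +o lideal c \<in> lcarrier (quot_lmodule c)" for r
    by (simp add: quot_lmodule_carrier)
  have "r \<in> lideal c \<longleftrightarrow> r * x \<in> lideal a \<and> r * y \<in> lideal b" for r
  proof -
    have "r \<in> lideal c \<longleftrightarrow> r +o lideal c = 0 +o lideal c"
      by (simp add: coset_eq_iff del: set_zero_plus)
    also have "\<dots> \<longleftrightarrow> \<phi> (r +o lideal c) = \<phi> (0 +o lideal c)"
      using inj_on_eq_iff [OF inj mem mem] by blast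
    also have "\<dots> \<longleftrightarrow> r * x \<in> lideal a \<and> r * y \<in> lideal b"
      by (simp add: \<phi> coset_eq_iff del: set_zero_plus)
    finally show ?thesis .
  qed
  then show ?thesis by blast
qed

lemma quot_lmodule_iso:
  fixes a b :: "'a::ring_1_no_zero_divisors"
  assumes xy: "x * a + b * y = 1"
  shows "lmodule_iso (quot_lmodule (a * b)) (lmodule_sum (quot_lmodule a) (quot_lmodule b))"
proof -
  \<comment> \<open>The map sends the coset of \<open>r\<close> to the cosets of
    \<open>r * y\<close> and \<open>r\<close>; by \<open>eq_iff\<close> the chosen representative
    does not matter.\<close>
  define \<phi> where "\<phi> C = (let r = SOME r. C = r +o lideal (a * b)
    in ((r * y) +o lideal a, r +o lideal b))" for C
  have ker: "r \<in> lideal (a * b) \<longleftrightarrow> r * y \<in> lideal a \<and> r \<in> lideal b" for r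
    using lideal_mult_eq_colon [OF xy] by blast
  have eq_iff: "r +o lideal (a * b) = s +o lideal (a * b) \<longleftrightarrow>
      (r * y) +o lideal a = (s * y) +o lideal a \<and> r +o lideal b = s +o lideal b" for r s
    by (simp add: coset_eq_iff ker left_diff_distrib)
  have \<phi>: "\<phi> (r +o lideal (a * b)) = ((r * y) +o lideal a, r +o lideal b)" for r
  proof -
    have "r +o lideal (a * b) = (SOME s. r +o lideal (a * b) = s +o lideal (a * b)) +o lideal (a * b)"
      by (rule someI_ex) blast
    then show ?thesis by (simp add: \<phi>_def Let_def eq_iff)
  qed
  have surj: "\<exists>r. ((r * y) +o lideal a, r +o lideal b) = (s +o lideal a, t +o lideal b)" for s t
  proof -
    \<comment> \<open>Chinese remaindering: \<open>b * y\<close> is \<open>1\<close> modulo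
      \<open>Ra\<close>, so \<open>s * b * y\<close> is \<open>s\<close> and
      \<open>t * (1 - y * b) * y = t * y * (1 - b * y)\<close> is \<open>0\<close> there, while
      modulo \<open>Rb\<close> only \<open>t\<close> survives.\<close>
    let ?r = "s * b + t * (1 - y * b)"
    have bxy: "b * y = 1 - x * a" using xy by (simp add: algebra_simps)
    have "?r * y - s = s * (b * y) + t * (y - y * (b * y)) - s" by (simp add: algebra_simps)
    also have "\<dots> = (t * y * x - s * x) * a" unfolding bxy by (simp add: algebra_simps)
    finally have "?r * y - s \<in> lideal a" by (auto simp: mem_lideal)
    moreover have "?r - t = (s - t * y) * b" by (simp add: algebra_simps)
    then have "?r - t \<in> lideal b" by (auto simp: mem_lideal)
    ultimately show ?thesis by (auto simp: coset_eq_iff intro!: exI [of _ ?r])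
  qed
  have "bij_betw \<phi> (lcarrier (quot_lmodule (a * b)))
      (lcarrier (lmodule_sum (quot_lmodule a) (quot_lmodule b)))"
    unfolding bij_betw_def
  proof
    show "inj_on \<phi> (lcarrier (quot_lmodule (a * b)))"
      by (auto simp: inj_on_def quot_lmodule_carrier \<phi> eq_iff)
    show "\<phi> ` lcarrier (quot_lmodule (a * b)) =
        lcarrier (lmodule_sum (quot_lmodule a) (quot_lmodule b))"
    proof
      show "\<phi> ` lcarrier (quot_lmodule (a * b)) \<subseteq>
          lcarrier (lmodule_sum (quot_lmodule a) (quot_lmodule b))"
        by (auto simp: quot_lmodule_carrier lmodule_sum_def \<phi>)
      show "lcarrier (lmodule_sum (quot_lmodule a) (quot_lmodule b)) \<subseteq>
          \<phi> ` lcarrier (quot_lmodule (a * b))"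
      proof
        fix C assume "C \<in> lcarrier (lmodule_sum (quot_lmodule a) (quot_lmodule b))"
        then obtain s t where "C = (s +o lideal a, t +o lideal b)"
          by (auto simp: quot_lmodule_carrier lmodule_sum_def)
        then obtain r where "C = \<phi> (r +o lideal (a * b))" using surj \<phi> by metis
        then show "C \<in> \<phi> ` lcarrier (quot_lmodule (a * b))" by (auto simp: quot_lmodule_carrier)
      qed
    qed
  qed
  moreover have "\<phi> (ladd (quot_lmodule (a * b)) C D) =
      ladd (lmodule_sum (quot_lmodule a) (quot_lmodule b)) (\<phi> C) (\<phi> D)"
    if CD: "C \<in> lcarrier (quot_lmodule (a * b))" "D \<in> lcarrier (quot_lmodule (a * b))" for C D
  proof -
    obtain r s where "C = r +o lideal (a * b)" "D = s +o lideal (a * b)"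
      using CD by (auto simp: quot_lmodule_carrier)
    then show ?thesis by (simp add: quot_lmodule_ladd \<phi> lmodule_sum_def distrib_right)
  qed
  moreover have "\<phi> (lsmult (quot_lmodule (a * b)) r C) =
      lsmult (lmodule_sum (quot_lmodule a) (quot_lmodule b)) r (\<phi> C)"
    if C: "C \<in> lcarrier (quot_lmodule (a * b))" for r C
  proof -
    obtain s where "C = s +o lideal (a * b)" using C by (auto simp: quot_lmodule_carrier)
    then show ?thesis by (simp add: quot_lmodule_lsmult \<phi> lmodule_sum_def mult.assoc)
  qed
  ultimately show ?thesis unfolding lmodule_iso_def by blast
qed

section \<open>Equivalence of the seven conditions\<close>

theorem theorem5p12:
  fixes a b :: "'a::ring_1_no_zero_divisors"
  assumes "two_fir TYPE('a)" and "a \<notin> ring_units" and "b \<notin> ring_units"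
  shows
    "(fully_reducible (a * b) \<longleftrightarrow>
        fully_reducible a \<and> fully_reducible b \<and>
        lmodule_iso (quot_lmodule (a * b)) (lmodule_sum (quot_lmodule a) (quot_lmodule b))) \<and>
     (fully_reducible (a * b) \<longleftrightarrow>
        fully_reducible a \<and> fully_reducible b \<and> 1 \<in> lideal a + rideal b) \<and>
     (fully_reducible (a * b) \<longleftrightarrow>
        fully_reducible a \<and> fully_reducible b \<and> (\<forall>p\<in>V a. fully_reducible (p * b))) \<and>
     (fully_reducible (a * b) \<longleftrightarrow>
        fully_reducible a \<and> fully_reducible b \<and>
        (\<forall>B. finite B \<and> F_basis B (V a) \<longrightarrow> (\<forall>p\<in>B. fully_reducible (p * b)))) \<and>
     (fully_reducible (a * b) \<longleftrightarrow>
        fully_reducible a \<and> fully_reducible b \<and>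
        (\<forall>p\<in>V a. \<forall>q\<in>V' b. fully_reducible (p * q))) \<and>
     (fully_reducible (a * b) \<longleftrightarrow>
        fully_reducible a \<and> fully_reducible b \<and> idealizer a \<subseteq> lideal a + rideal b)"
proof -
  let ?i = "fully_reducible (a * b)"
  let ?fr = "fully_reducible a \<and> fully_reducible b"
  note fir = assms(1)
  note iii = fully_reducible_mult_iff [OF fir]
  have ii: "?i \<longleftrightarrow> fully_reducible a \<and> fully_reducible b \<and>
      lmodule_iso (quot_lmodule (a * b)) (lmodule_sum (quot_lmodule a) (quot_lmodule b))"
  proof
    assume ?i
    then have fr: "?fr" and "1 \<in> lideal a + rideal b" using iii by blast+
    then obtain x y where "x * a + b * y = 1" by (metis mem_lideal_plus_rideal)
    then show "fully_reducible a \<and> fully_reducible b \<and>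
      lmodule_iso (quot_lmodule (a * b)) (lmodule_sum (quot_lmodule a) (quot_lmodule b))"
      using fr quot_lmodule_iso by blast
  next
    assume *: "fully_reducible a \<and> fully_reducible b \<and>
      lmodule_iso (quot_lmodule (a * b)) (lmodule_sum (quot_lmodule a) (quot_lmodule b))"
    then have "a * b \<noteq> 0" using fully_reducible_nonzero by auto
    moreover obtain x y where "lideal (a * b) = {r. r * x \<in> lideal a \<and> r * y \<in> lideal b}"
      using * quot_lmodule_iso_annihilator by blast
    ultimately show ?i using * colon_pair_inter [OF fir] by blast
  qed
  have iv: "fully_reducible (p * b)" if i: "?i" and p: "p \<in> V a" for p
  proof -
    obtain c where "a = c * p" using p by (auto simp: V_def mem_lideal)
    then show ?thesis using i fully_reducible_right_factor [OF fir, of c] by (simp add: mult.assoc)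
  qed
  \<comment> \<open>Bases lie in \<open>V a\<close>, so this one implication gives the way back to
    (i) from (iv), from (v) and, through \<open>vi'\<close>, from (vi).\<close>
  have v: ?i if fr: "?fr" and B: "\<And>B p. finite B \<Longrightarrow> F_basis B (V a) \<Longrightarrow> p \<in> B \<Longrightarrow> fully_reducible (p * b)"
  proof -
    obtain B where B': "finite B" "F_basis B (V a)" "lideal a = (\<Inter>p\<in>B. lideal p)"
      using finite_F_basis [OF fir] fr assms(2) by blast
    then have "B \<noteq> {}" using assms(2) lideal_UNIV_iff by fastforce
    then show ?i
      using fully_reducible_mult_of_atoms [OF fir] B' B fr fully_reducible_nonzero by metis
  qed
  have vi: "fully_reducible (p * q)" if i: "?i" and p: "p \<in> V a" and q: "q \<in> V' b" for p q
  proof -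
    obtain d where "b = q * d" using q by (auto simp: V'_def mem_rideal)
    then show ?thesis
      using iv [OF i p] fully_reducible_left_factor [OF fir, of "p * q" d]
      by (simp add: mult.assoc)
  qed
  have vi': "fully_reducible (p * b)"
    if fr: "?fr" and p: "p \<in> V a" and q: "\<forall>q\<in>V' b. fully_reducible (p * q)" for p
  proof -
    obtain c where "a = c * p" using p by (auto simp: V_def mem_lideal)
    then have "fully_reducible p" using fr fully_reducible_right_factor [OF fir] by blast
    moreover have "1 \<in> lideal p + rideal b"
      \<comment> \<open>Here \<open>p\<close> takes the role of \<open>L\<close>: each
        \<open>p * q\<close> is fully reducible, hence \<open>p\<close> is comaximal with every
        \<open>q\<close> in \<open>V' b\<close>.\<close>
      using comaximal_of_atoms [OF fir] fr q iii by blast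
    ultimately show ?thesis using fr iii by blast
  qed
  have BV: "B \<subseteq> V a" if "F_basis B (V a)" for B using that by (simp add: F_basis_def)
  have vii: "idealizer a \<subseteq> lideal a + rideal b \<longleftrightarrow> 1 \<in> lideal a + rideal b"
  proof
    have "1 \<in> idealizer a" by (simp add: idealizer_def)
    then show "idealizer a \<subseteq> lideal a + rideal b \<Longrightarrow> 1 \<in> lideal a + rideal b" by blast
  next
    assume "1 \<in> lideal a + rideal b"
    then obtain x y where xy: "1 = x * a + b * y" by (auto simp: mem_lideal_plus_rideal)
    show "idealizer a \<subseteq> lideal a + rideal b"
    proof
      fix f assume "f \<in> idealizer a"
      then obtain g where g: "a * f = g * a" by (auto simp: idealizer_def mem_lideal)
      \<comment> \<open>The idealizer relation \<open>a * f = g * a\<close> moves the first summand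
        into \<open>Ra\<close>.\<close>
      have "f = (x * a + b * y) * f" unfolding xy [symmetric] by simp
      also have "\<dots> = x * (a * f) + b * (y * f)" by (simp add: algebra_simps)
      finally have "f = (x * g) * a + b * (y * f)" by (simp add: g mult.assoc)
      then show "f \<in> lideal a + rideal b" unfolding mem_lideal_plus_rideal by blast
    qed
  qed
  have fr: ?fr if ?i using that iii by blast
  show ?thesis
  proof (intro conjI)
    show "?i \<longleftrightarrow> fully_reducible a \<and> fully_reducible b \<and> (\<forall>p\<in>V a. fully_reducible (p * b))"
      using fr iv v BV by blast
    show "?i \<longleftrightarrow> fully_reducible a \<and> fully_reducible b \<and>
        (\<forall>B. finite B \<and> F_basis B (V a) \<longrightarrow> (\<forall>p\<in>B. fully_reducible (p * b)))"
      using fr iv v BV by blast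
    show "?i \<longleftrightarrow> fully_reducible a \<and> fully_reducible b \<and>
        (\<forall>p\<in>V a. \<forall>q\<in>V' b. fully_reducible (p * q))"
      using fr vi vi' v BV by blast
  qed (use ii iii vii in blast)+
qed

end
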